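(* Let $n,p\geq 1$ and $r\geq 2$ be integers, and let $l=\lceil\log_r p\rceil$. Then there exists a non-empty $r$-hypergraph with $n$ vertices and at least $p$ distinct $r$-partitions if and only if $r+l\leq n$, in which case the maximum number of edges in such a hypergraph is $\pi_r(n-l)$.
   Context: A hypergraph is a pair $H=(V,\mathbb E)$ where $V$ is a finite set of vertices and $\mathbb E$ is a set of non-empty subsets of $V$ (edges). It is an $r$-hypergraph if every edge has exactly $r$ elements, and non-empty if it has at least one edge. An $r$-partition of an $r$-hypergraph $H$ is a partition of the vertex set $V$ such that every edge is a transversal of it (i.e. contains exactly one point from each block). For $1\leq r\leq m$, $\pi_r(m)$ denotes the maximum of $s_1\cdots s_r$ over all $r$-tuples $(s_1,\dots,s_r)$ of positive integers with $s_1+\cdots+s_r=m$. *)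

theory Defs
  imports Complex_Main "HOL-Library.Disjoint_Sets" "HOL-Library.Infinite_Typeclass"
begin

definition hypergraph :: "'a set \<Rightarrow> 'a set set \<Rightarrow> bool" where
  "hypergraph V E \<longleftrightarrow> finite V \<and> (\<forall>e\<in>E. e \<noteq> {} \<and> e \<subseteq> V)"

definition r_hypergraph :: "nat \<Rightarrow> 'a set \<Rightarrow> 'a set set \<Rightarrow> bool" where
  "r_hypergraph r V E \<longleftrightarrow> hypergraph V E \<and> (\<forall>e\<in>E. card e = r)"

definition transversal :: "'a set set \<Rightarrow> 'a set \<Rightarrow> bool" where
  "transversal P e \<longleftrightarrow> (\<forall>B\<in>P. \<exists>!x. x \<in> e \<inter> B)"

text \<open>For an \<open>r\<close>-hypergraph with at least one edge, having an edge as a transversal forces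
  exactly \<open>r\<close> blocks, so \<open>r\<close> need not be a parameter here.\<close>
definition r_partitions :: "'a set \<Rightarrow> 'a set set \<Rightarrow> 'a set set set" where
  "r_partitions V E = {P. partition_on V P \<and> (\<forall>e\<in>E. transversal P e)}"

text \<open>Meaningful only for \<open>1 \<le> r \<le> m\<close>; otherwise the maximum may be taken over the empty set.\<close>
definition max_prod :: "nat \<Rightarrow> nat \<Rightarrow> nat" where
  "max_prod r m = Max {prod_list s | s :: nat list.
     length s = r \<and> (\<forall>x\<in>set s. 0 < x) \<and> sum_list s = m}"

text \<open>The cardinalities and maxima in use are those of finite sets.\<close>

lemma finite_r_partitions:
  assumes "finite V"
  shows "finite (r_partitions V E)"
proof (rule finite_subset)
  show "r_partitions V E \<subseteq> Pow (Pow V)"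
    unfolding r_partitions_def partition_on_def by auto
qed (use assms in simp)

lemma finite_max_prod:
  "finite {prod_list s | s :: nat list. length s = r \<and> (\<forall>x\<in>set s. 0 < x) \<and> sum_list s = m}"
proof (rule finite_subset)
  show "{prod_list s | s :: nat list. length s = r \<and> (\<forall>x\<in>set s. 0 < x) \<and> sum_list s = m}
    \<subseteq> prod_list ` {s. set s \<subseteq> {..m} \<and> length s = r}"
    by (auto intro!: imageI dest: member_le_sum_list)
qed (simp add: finite_lists_length_eq)

lemma max_prod_nonempty:
  assumes "1 \<le> r" "r \<le> m"
  shows "{prod_list s | s :: nat list.
    length s = r \<and> (\<forall>x\<in>set s. 0 < x) \<and> sum_list s = m} \<noteq> {}"
proof -
  let ?s = "(m - (r - 1)) # replicate (r - 1) (1::nat)"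
  have "length ?s = r \<and> (\<forall>x\<in>set ?s. 0 < x) \<and> sum_list ?s = m"
    using assms by (auto simp: sum_list_replicate)
  then show ?thesis by blast
qed

lemma finite_edge_counts:
  "finite {card E | (V :: 'a set) E. r_hypergraph r V E \<and> E \<noteq> {} \<and> card V = n
     \<and> p \<le> card (r_partitions V E)}"
proof (rule finite_subset)
  have "card E \<le> 2 ^ n" if "r_hypergraph r V E" "card V = n" for V :: "'a set" and E
  proof -
    have "finite V" "E \<subseteq> Pow V"
      using that by (auto simp: r_hypergraph_def hypergraph_def)
    then have "card E \<le> card (Pow V)"
      by (intro card_mono) auto
    then show ?thesis
      using \<open>finite V\<close> that by (simp add: card_Pow)
  qed
  then show "{card E | (V :: 'a set) E. r_hypergraph r V E \<and> E \<noteq> {} \<and> card V = n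
     \<and> p \<le> card (r_partitions V E)} \<subseteq> {..2 ^ n}"
    by auto
qed simp

end

theory Submission
  imports Defs "HOL-Library.FuncSet" "HOL-Library.Nat_Bijection"
begin

text \<open>Fix an edge \<open>d\<close>. Naming each block of an \<open>r\<close>-partition after its unique point in \<open>d\<close> turns
  \<open>r\<close>-partitions into retractions of \<open>V\<close> onto \<open>d\<close> that map every edge bijectively to \<open>d\<close>.

  Upper bound, by induction on \<open>l\<close>. If there are more than \<open>r ^ (l - 1)\<close> such colourings and
  \<open>l \<ge> 1\<close>, some vertex \<open>v\<close> does not have a constant colour; let \<open>w\<close> be its most frequent colour.
  Identifying \<open>v\<close> with \<open>w\<close> removes one vertex and keeps at least a fraction \<open>1 / r\<close> of the
  colourings. It does not merge two edges, since two edges that differ only in \<open>v\<close> and \<open>w\<close> would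
  force \<open>v\<close> to have constant colour \<open>w\<close>. For \<open>l = 0\<close> a single colouring embeds the edges into
  the product of its colour classes.

  The bound is attained by a complete \<open>r\<close>-partite hypergraph together with \<open>l\<close> isolated vertices,
  whose colours can be chosen freely.\<close>

section \<open>Colourings by a reference edge and their correspondence with
  \<open>r\<close>-partitions\<close>

text \<open>Fixing \<open>d\<close> pointwise names each class by its own point of \<open>d\<close>,
  so that a partition is not counted once for every permutation of the colours. Extensionality
  outside \<open>V\<close> makes colourings that agree on \<open>V\<close> equal, as counting
  requires.\<close>

definition edge_colourings :: "'a set \<Rightarrow> 'a set set \<Rightarrow> 'a set \<Rightarrow> ('a \<Rightarrow> 'a) set" where
  "edge_colourings V E d =
    {f \<in> V \<rightarrow>\<^sub>E d. (\<forall>x\<in>d. f x = x) \<and> (\<forall>e\<in>E. bij_betw f e d)}"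

lemma finite_edge_colourings:
  assumes "finite V" "d \<subseteq> V"
  shows "finite (edge_colourings V E d)"
proof (rule finite_subset)
  show "edge_colourings V E d \<subseteq> V \<rightarrow>\<^sub>E d"
    by (auto simp: edge_colourings_def)
  show "finite (V \<rightarrow>\<^sub>E d)"
    using assms by (intro finite_PiE) (auto intro: finite_subset)
qed

text \<open>A map that is bijective from an edge onto \<open>d\<close> meets each of its fibres over
  \<open>d\<close> exactly once on that edge. The fibre over \<open>w\<close> is non-empty because
  it contains \<open>w\<close> itself.\<close>

lemma colour_classes_mem_r_partitions:
  assumes f: "f \<in> edge_colourings V E d" and sub: "\<And>e. e \<in> E \<Longrightarrow> e \<subseteq> V" and "d \<in> E"
  shows "(\<lambda>w. {x\<in>V. f x = w}) ` d \<in> r_partitions V E"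
  unfolding r_partitions_def
proof (intro CollectI conjI ballI)
  have d: "d \<subseteq> V"
    using assms by auto
  have fd: "\<And>w. w \<in> d \<Longrightarrow> f w = w" and fV: "\<And>x. x \<in> V \<Longrightarrow> f x \<in> d"
    and bij: "\<And>e. e \<in> E \<Longrightarrow> bij_betw f e d"
    using f by (auto simp: edge_colourings_def)
  show "partition_on V ((\<lambda>w. {x\<in>V. f x = w}) ` d)"
  proof (rule partition_onI)
    show "\<Union> ((\<lambda>w. {x\<in>V. f x = w}) ` d) = V"
      using fV by auto
    show "disjnt p q" if "p \<in> (\<lambda>w. {x\<in>V. f x = w}) ` d" "q \<in> (\<lambda>w. {x\<in>V. f x = w}) ` d" "p \<noteq> q"
      for p q
      using that by (auto simp: disjnt_def)
    show "{} \<notin> (\<lambda>w. {x\<in>V. f x = w}) ` d"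
      using d fd by blast
  qed
  show "transversal ((\<lambda>w. {x\<in>V. f x = w}) ` d) e" if e: "e \<in> E" for e
    unfolding transversal_def
  proof
    fix B assume "B \<in> (\<lambda>w. {x\<in>V. f x = w}) ` d"
    then obtain w where w: "w \<in> d" "B = {x\<in>V. f x = w}"
      by auto
    then obtain x where x: "x \<in> e" "f x = w"
      using bij[OF e] by (auto simp: bij_betw_def)
    have "y = x" if "y \<in> e" "f y = w" for y
      using bij[OF e] that x by (auto simp: bij_betw_def dest: inj_onD)
    then show "\<exists>!x. x \<in> e \<inter> B"
      using x w sub[OF e] by auto
  qed
qed

text \<open>The inverse sends a partition to the map taking each vertex to the unique point of
  \<open>d\<close> in its block.\<close>

lemma bij_betw_colourings_r_partitions:
  assumes sub: "\<And>e. e \<in> E \<Longrightarrow> e \<subseteq> V" and "d \<in> E"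
  shows "bij_betw (\<lambda>f. (\<lambda>w. {x\<in>V. f x = w}) ` d) (edge_colourings V E d) (r_partitions V E)"
  unfolding bij_betw_def
proof (intro conjI equalityI subsetI)
  have d: "d \<subseteq> V"
    using assms by auto
  show "inj_on (\<lambda>f. (\<lambda>w. {x\<in>V. f x = w}) ` d) (edge_colourings V E d)"
  proof (rule inj_onI)
    fix f g
    assume f: "f \<in> edge_colourings V E d" and g: "g \<in> edge_colourings V E d"
      and eq: "(\<lambda>w. {x\<in>V. f x = w}) ` d = (\<lambda>w. {x\<in>V. g x = w}) ` d"
    show "f = g"
    proof (rule PiE_ext)
      show "f \<in> V \<rightarrow>\<^sub>E d" "g \<in> V \<rightarrow>\<^sub>E d"
        using f g by (auto simp: edge_colourings_def)
      fix x assume x: "x \<in> V"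
      then have fx: "f x \<in> d"
        using f by (auto simp: edge_colourings_def)
      then have "{y\<in>V. f y = f x} \<in> (\<lambda>w. {x\<in>V. g x = w}) ` d"
        using eq by blast
      then obtain w where w: "{y\<in>V. f y = f x} = {y\<in>V. g y = w}"
        by auto
      \<comment> \<open>The colour \<open>f x\<close> lies in its own class and is also fixed by
        \<open>g\<close>, so it is the name of this class under \<open>g\<close> too.\<close>
      have "f x \<in> {y\<in>V. f y = f x}"
        using fx f d by (auto simp: edge_colourings_def)
      then have "g (f x) = w"
        using w by auto
      then have "f x = w"
        using fx g by (auto simp: edge_colourings_def)
      moreover have "g x = w"
        using w x by auto
      ultimately show "f x = g x"
        by simp
    qed
  qed
next
  fix P assume "P \<in> (\<lambda>f. (\<lambda>w. {x\<in>V. f x = w}) ` d) ` edge_colourings V E d"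
  then show "P \<in> r_partitions V E"
    using colour_classes_mem_r_partitions assms by auto
next
  have d: "d \<subseteq> V"
    using assms by auto
  fix P assume P: "P \<in> r_partitions V E"
  then have part: "partition_on V P" and tr: "\<And>e B. e \<in> E \<Longrightarrow> B \<in> P \<Longrightarrow> \<exists>!x. x \<in> e \<inter> B"
    by (auto simp: r_partitions_def transversal_def)
  \<comment> \<open>\<open>B x\<close> will be the block of \<open>x\<close>, and \<open>f x\<close>
    the point where \<open>d\<close> meets it.\<close>
  have "\<exists>w B. B \<in> P \<and> x \<in> B \<and> w \<in> d \<and> w \<in> B" if "x \<in> V" for x
    using that part tr[OF \<open>d \<in> E\<close>] unfolding partition_on_def by blast
  then obtain f B where fB: "\<And>x. x \<in> V \<Longrightarrow> B x \<in> P \<and> x \<in> B x \<and> f x \<in> d \<and> f x \<in> B x"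
    by metis
  have same: "C = D" if "C \<in> P" "D \<in> P" "x \<in> C" "x \<in> D" for C D x
    using part that by (auto simp: partition_on_def disjoint_def)
  have block: "B x = C" if "x \<in> C" "C \<in> P" for x C
    using same fB that part by (metis UnionI partition_on_def)
  have f_eq: "f x = w" if "x \<in> C" "C \<in> P" "w \<in> d" "w \<in> C" for x w C
  proof -
    have "x \<in> V"
      using that part by (auto simp: partition_on_def)
    then show ?thesis
      using fB[of x] block[OF that(1,2)] tr[OF \<open>d \<in> E\<close> that(2)] that by blast
  qed
  define g where "g = restrict f V"
  have gd: "g x = x" if "x \<in> d" for x
    using that d f_eq fB[of x] by (auto simp: g_def)
  have "bij_betw g e d" if e: "e \<in> E" for e
    unfolding bij_betw_def
  proof (intro conjI inj_onI equalityI subsetI)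
    have eV: "e \<subseteq> V"
      using sub e .
    show "x = y" if "x \<in> e" "y \<in> e" "g x = g y" for x y
    proof -
      have "f x = f y"
        using that eV by (simp add: g_def subset_iff)
      \<comment> \<open>Both blocks contain \<open>f x\<close>; the transversality of
        \<open>e\<close> then leaves only one point of \<open>e\<close> in them.\<close>
      then have "B x = B y"
        using same fB that eV by (metis subsetD)
      then show ?thesis
        using tr[OF e, of "B x"] fB[of x] fB[of y] that eV by auto
    qed
    show "y \<in> d" if "y \<in> g ` e" for y
      using that eV fB by (auto simp: g_def)
    show "y \<in> g ` e" if y: "y \<in> d" for y
    proof -
      obtain x where x: "x \<in> e" "x \<in> B y"
        using tr[OF e, of "B y"] fB[of y] y d by auto
      then have "f x = y"
        using f_eq[of x "B y" y] fB[of y] y d by auto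
      then show ?thesis
        using x eV by (auto simp: g_def)
    qed
  qed
  then have g: "g \<in> edge_colourings V E d"
    using gd fB by (auto simp: edge_colourings_def g_def)
  have cls: "{x\<in>V. g x = w} = C" if "w \<in> d" "w \<in> C" "C \<in> P" for w C
  proof -
    have "C \<subseteq> V"
      using that part by (auto simp: partition_on_def)
    moreover have "x \<in> C" if "x \<in> V" "g x = w" for x
      using that fB[of x] same \<open>w \<in> C\<close> \<open>C \<in> P\<close> by (auto simp: g_def)
    ultimately show ?thesis
      using f_eq that by (auto simp: g_def)
  qed
  have "P = (\<lambda>w. {x\<in>V. g x = w}) ` d"
  proof (intro equalityI subsetI)
    fix C assume "C \<in> P"
    moreover from this obtain w where "w \<in> d" "w \<in> C"
      using tr[OF \<open>d \<in> E\<close>] by blast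
    ultimately show "C \<in> (\<lambda>w. {x\<in>V. g x = w}) ` d"
      using cls by blast
  next
    fix C assume "C \<in> (\<lambda>w. {x\<in>V. g x = w}) ` d"
    then obtain w where w: "w \<in> d" "C = {x\<in>V. g x = w}"
      by auto
    then have "C = B w"
      using cls[of w "B w"] fB[of w] d by auto
    then show "C \<in> P"
      using fB[of w] d w by auto
  qed
  then show "P \<in> (\<lambda>f. (\<lambda>w. {x\<in>V. f x = w}) ` d) ` edge_colourings V E d"
    using g by blast
qed

lemma card_r_partitions_eq:
  assumes "\<And>e. e \<in> E \<Longrightarrow> e \<subseteq> V" and "d \<in> E"
  shows "card (r_partitions V E) = card (edge_colourings V E d)"
  using bij_betw_same_card[OF bij_betw_colourings_r_partitions[of E V d]] assms by simp

section \<open>Bounding the number of edges by a single colouring\<close>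

text \<open>The inverse of \<open>f\<close> on an edge is a choice function for the colour classes,
  and its image of \<open>d\<close> gives the edge back.\<close>

lemma card_edges_le_prod_classes:
  assumes "finite V" and sub: "\<And>e. e \<in> E \<Longrightarrow> e \<subseteq> V" and "d \<subseteq> V"
    and f: "f \<in> edge_colourings V E d"
  shows "card E \<le> (\<Prod>w\<in>d. card {x\<in>V. f x = w})"
proof -
  have "finite d"
    using \<open>d \<subseteq> V\<close> \<open>finite V\<close> by (rule finite_subset)
  have bij: "\<And>e. e \<in> E \<Longrightarrow> bij_betw f e d"
    using f by (auto simp: edge_colourings_def)
  let ?t = "\<lambda>e. restrict (inv_into e f) d"
  have "inj_on ?t E"
  proof (rule inj_onI)
    fix a b assume ab: "a \<in> E" "b \<in> E" "?t a = ?t b"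
    have "inv_into e f ` d = e" if "e \<in> E" for e
      using bij_betw_inv_into[OF bij[OF that]] by (simp add: bij_betw_def)
    then have "?t e ` d = e" if "e \<in> E" for e
      using that by simp
    then show "a = b"
      using ab by metis
  qed
  moreover have "?t ` E \<subseteq> (\<Pi>\<^sub>E w\<in>d. {x\<in>V. f x = w})"
  proof (intro image_subsetI restrict_PiE_iff[THEN iffD2] ballI CollectI conjI)
    fix e w assume e: "e \<in> E" and w: "w \<in> d"
    then have "w \<in> f ` e"
      using bij by (auto simp: bij_betw_def)
    then show "inv_into e f w \<in> V" "f (inv_into e f w) = w"
      using sub[OF e] inv_into_into[of w f e] by (auto simp: f_inv_into_f)
  qed
  moreover have "finite (\<Pi>\<^sub>E w\<in>d. {x\<in>V. f x = w})"
    using \<open>finite V\<close> \<open>finite d\<close> by (intro finite_PiE) auto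
  ultimately have "card E \<le> card (\<Pi>\<^sub>E w\<in>d. {x\<in>V. f x = w})"
    by (rule card_inj_on_le)
  then show ?thesis
    using \<open>finite d\<close> by (simp add: card_PiE)
qed

text \<open>The witness lists the sizes of the colour classes, which are positive and add up to
  \<open>card V\<close>. The list form matches \<open>max_prod\<close>.\<close>

lemma card_edges_le_prod_list:
  assumes "finite V" and "\<And>e. e \<in> E \<Longrightarrow> e \<subseteq> V" and d: "d \<subseteq> V"
    and f: "f \<in> edge_colourings V E d"
  shows "\<exists>s. length s = card d \<and> (\<forall>x\<in>set s. 0 < x) \<and> sum_list s = card V \<and> card E \<le> prod_list s"
proof -
  have "finite d"
    using \<open>d \<subseteq> V\<close> \<open>finite V\<close> by (rule finite_subset)
  then obtain xs where xs: "distinct xs" "set xs = d"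
    using finite_distinct_list by blast
  let ?c = "\<lambda>w. card {x\<in>V. f x = w}"
  have "0 < ?c w" if "w \<in> d" for w
  proof -
    have "w \<in> {x\<in>V. f x = w}"
      using that f d by (auto simp: edge_colourings_def)
    then show ?thesis
      using \<open>finite V\<close> by (auto simp: card_gt_0_iff)
  qed
  moreover have "sum_list (map ?c xs) = card V"
  proof -
    have "sum ?c d = card V"
      using sum.group[of V d f "\<lambda>_. 1::nat"]
        \<open>finite V\<close> \<open>finite d\<close> f by (auto simp: edge_colourings_def)
    then show ?thesis
      using xs by (simp add: sum_list_distinct_conv_sum_set)
  qed
  moreover have "prod_list (map ?c xs) = prod ?c d"
    using xs prod.distinct_set_conv_list[of xs ?c] by simp
  ultimately show ?thesis
    using xs card_edges_le_prod_classes[OF assms] distinct_card[of xs]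
    by (intro exI[of _ "map ?c xs"]) auto
qed

section \<open>Identifying a vertex with one of its colours\<close>

text \<open>Two distinct colourings differ at some \<open>v\<close>, and no colour equals both
  values. The conclusion covers every \<open>w\<close>, since the colour to be avoided is chosen
  only later, by frequency.\<close>

lemma exists_nonconstant_vertex:
  assumes "1 < card (edge_colourings V E d)"
  obtains v where "v \<in> V" "\<And>w. w \<in> d \<Longrightarrow> \<exists>f\<in>edge_colourings V E d. f v \<noteq> w"
proof -
  have "\<not> card (edge_colourings V E d) \<le> Suc 0" "finite (edge_colourings V E d)"
    using assms by (auto intro: card_ge_0_finite)
  then obtain f g where fg: "f \<in> edge_colourings V E d" "g \<in> edge_colourings V E d" "f \<noteq> g"
    using card_le_Suc0_iff_eq by metis
  then have "f \<in> V \<rightarrow>\<^sub>E d" "g \<in> V \<rightarrow>\<^sub>E d"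
    by (auto simp: edge_colourings_def)
  then obtain v where "v \<in> V" "f v \<noteq> g v"
    using fg(3) PiE_ext by metis
  then show ?thesis
    using that fg by metis
qed

text \<open>Pigeonhole principle: the colour of \<open>v\<close> splits the colourings into
  \<open>card d\<close> classes.\<close>

lemma exists_frequent_colour:
  assumes "finite V" "d \<subseteq> V" "v \<in> V" and gt: "card d * m < card (edge_colourings V E d)"
  obtains w where "w \<in> d" "m < card {f \<in> edge_colourings V E d. f v = w}"
proof (rule ccontr)
  assume "\<not> thesis"
  then have le: "card {f \<in> edge_colourings V E d. f v = w} \<le> m" if "w \<in> d" for w
    using that \<open>\<And>w. w \<in> d \<Longrightarrow> m < card {f \<in> edge_colourings V E d. f v = w} \<Longrightarrow> thesis\<close>
      not_less by blast
  have "edge_colourings V E d = (\<Union>w\<in>d. {f \<in> edge_colourings V E d. f v = w})"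
    using \<open>v \<in> V\<close> by (auto simp: edge_colourings_def)
  then have "card (edge_colourings V E d) = card (\<Union>w\<in>d. {f \<in> edge_colourings V E d. f v = w})"
    by (rule arg_cong)
  also have "\<dots> \<le> (\<Sum>w\<in>d. card {f \<in> edge_colourings V E d. f v = w})"
    using finite_subset[OF \<open>d \<subseteq> V\<close> \<open>finite V\<close>] by (rule card_UN_le)
  also have "\<dots> \<le> (\<Sum>w\<in>d. m)"
    using le by (rule sum_mono)
  finally show False
    using gt by simp
qed

text \<open>Distinct edges with the same image would differ by exchanging \<open>v\<close> for
  \<open>w\<close>. Every colouring would then have to give \<open>v\<close> the colour
  \<open>w\<close>, which \<open>g\<close> does not.\<close>

lemma inj_on_identify_vertices:
  assumes "w \<in> d" and f: "f \<in> edge_colourings V E d" "f v = w"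
    and g: "g \<in> edge_colourings V E d" "g v \<noteq> w" "g v \<in> d"
  shows "inj_on (image (id(v := w))) E"
proof (rule inj_onI)
  let ?m = "id(v := w)"
  fix a b assume ab: "a \<in> E" "b \<in> E" "?m ` a = ?m ` b"
  have "v \<noteq> w"
    using g \<open>w \<in> d\<close> by (auto simp: edge_colourings_def)
  \<comment> \<open>\<open>f\<close> gives \<open>v\<close> and \<open>w\<close> the same colour, so
    no edge contains both.\<close>
  have w_notin: "w \<notin> e" if "e \<in> E" "v \<in> e" for e
  proof
    assume "w \<in> e"
    moreover have "f w = w" "inj_on f e"
      using f \<open>w \<in> d\<close> that by (auto simp: edge_colourings_def bij_betw_def)
    ultimately show False
      using that f \<open>v \<noteq> w\<close> by (auto dest: inj_onD)
  qed
  have img: "?m ` e = (if v \<in> e then insert w (e - {v}) else e)" for e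
    by auto
  \<comment> \<open>The colour \<open>g v\<close> must occur on \<open>e'\<close>, but not at
    \<open>w\<close>. So it occurs on \<open>e - {v}\<close>, where it clashes with the injectivity
    of \<open>g\<close> on \<open>e\<close>.\<close>
  have no_merge: False if "e \<in> E" "e' \<in> E" "v \<in> e" "e' = insert w (e - {v})" for e e'
  proof -
    have "g ` e' = d" "inj_on g e" "g w = w"
      using g(1) that(1,2) \<open>w \<in> d\<close> by (auto simp: edge_colourings_def bij_betw_def)
    then have "g v \<in> insert w (g ` (e - {v}))"
      using \<open>e' = insert w (e - {v})\<close> \<open>g v \<in> d\<close> by (simp only: image_insert)
    then obtain x where "x \<in> e" "x \<noteq> v" "g v = g x"
      using g(2) by auto
    then show False
      using \<open>inj_on g e\<close> \<open>v \<in> e\<close> by (metis inj_onD)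
  qed
  show "a = b"
  proof (cases "v \<in> a"; cases "v \<in> b")
    assume "v \<in> a" "v \<in> b"
    then have "insert w (a - {v}) = insert w (b - {v})"
      using ab(3) by (simp only: img if_True)
    moreover have "w \<notin> a" "w \<notin> b"
      using w_notin ab(1,2) \<open>v \<in> a\<close> \<open>v \<in> b\<close> by auto
    ultimately have "a - {v} = b - {v}"
      by (metis Diff_iff insert_ident)
    then show ?thesis
      using \<open>v \<in> a\<close> \<open>v \<in> b\<close> by (metis insert_Diff)
  next
    assume "v \<in> a" "v \<notin> b"
    then have "b = insert w (a - {v})"
      using ab(3) by (simp only: img if_True if_False)
    then show ?thesis
      using no_merge[OF ab(1,2)] \<open>v \<in> a\<close> by blast
  next
    assume "v \<notin> a" "v \<in> b"
    then have "a = insert w (b - {v})"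
      using ab(3) by (simp only: img if_True if_False)
    then show ?thesis
      using no_merge[OF ab(2,1)] \<open>v \<in> b\<close> by blast
  next
    assume "v \<notin> a" "v \<notin> b"
    then show ?thesis
      using ab(3) by (simp only: img if_False)
  qed
qed

text \<open>A colouring with \<open>f v = w = f w\<close> factors through the identification, so its
  restriction colours the smaller hypergraph. Restriction loses only the value at \<open>v\<close>,
  which is known to be \<open>w\<close>.\<close>

lemma card_colourings_identify_vertices:
  assumes "finite V" and sub: "\<And>e. e \<in> E \<Longrightarrow> e \<subseteq> V" and d: "d \<subseteq> V" and "v \<in> V" "v \<notin> d" "w \<in> d"
  shows "card {f \<in> edge_colourings V E d. f v = w} \<le>
    card (edge_colourings (V - {v}) (image (id(v := w)) ` E) d)"
proof (rule card_inj_on_le)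
  let ?m = "id(v := w)"
  let ?F = "{f \<in> edge_colourings V E d. f v = w}"
  let ?r = "\<lambda>f. restrict f (V - {v})"
  show "finite (edge_colourings (V - {v}) (image ?m ` E) d)"
    using assms by (intro finite_edge_colourings) auto
  show "inj_on ?r ?F"
  proof (rule inj_onI)
    fix f g assume fg: "f \<in> ?F" "g \<in> ?F" "?r f = ?r g"
    show "f = g"
    proof (rule PiE_ext)
      show "f \<in> V \<rightarrow>\<^sub>E d" "g \<in> V \<rightarrow>\<^sub>E d"
        using fg by (auto simp: edge_colourings_def)
      show "f x = g x" if "x \<in> V" for x
        using fg(1,2) that fun_cong[OF fg(3), of x] by (cases "x = v") (auto simp: restrict_def)
    qed
  qed
  show "?r ` ?F \<subseteq> edge_colourings (V - {v}) (image ?m ` E) d"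
  proof (rule image_subsetI)
    fix f assume f: "f \<in> ?F"
    have "bij_betw (?r f) (?m ` e) d" if e: "e \<in> E" for e
    proof -
      have "f w = w" "f v = w"
        using f \<open>w \<in> d\<close> by (auto simp: edge_colourings_def)
      then have eq: "(?r f \<circ> ?m) x = f x" if "x \<in> e" for x
        using that sub[OF e] d \<open>w \<in> d\<close> \<open>v \<notin> d\<close> by auto
      have "bij_betw f e d"
        using f e by (auto simp: edge_colourings_def)
      then have bij: "bij_betw (?r f \<circ> ?m) e d"
        using eq by (subst bij_betw_cong[of e _ f]) auto
      then have "inj_on (?r f) (?m ` e)"
        by (intro inj_on_imageI) (simp add: bij_betw_def)
      then show ?thesis
        using bij by (simp only: bij_betw_def image_comp)
    qed
    then show "?r f \<in> edge_colourings (V - {v}) (image ?m ` E) d"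
      using f d \<open>v \<notin> d\<close> by (auto simp: edge_colourings_def)
  qed
qed

section \<open>The upper bound by induction on \<open>l\<close>\<close>

text \<open>The factor \<open>card d\<close> in the last hypothesis replaces an exponent
  \<open>l - 1\<close>, so that \<open>l = 0\<close> is covered; there it implies that some
  colouring exists. The edge \<open>d\<close> stays fixed in the induction because every
  identification preserves it.\<close>

lemma card_edges_le_of_many_colourings:
  assumes "finite V" and "\<And>e. e \<in> E \<Longrightarrow> e \<subseteq> V" and "d \<in> E" and "1 \<le> card d"
    and "card d ^ l < card d * card (edge_colourings V E d)"
  shows "\<exists>s. length s = card d \<and> (\<forall>x\<in>set s. 0 < x) \<and> sum_list s + l = card V
    \<and> card E \<le> prod_list s"
  using assms
proof (induction l arbitrary: V E)
  case 0
  then obtain f where "f \<in> edge_colourings V E d"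
    by fastforce
  then show ?case
    using card_edges_le_prod_list[of V E d f] 0 by auto
next
  case (Suc l)
  let ?C = "edge_colourings V E d"
  have d: "d \<subseteq> V"
    using Suc.prems by auto
  have many: "card d ^ l < card ?C"
    using Suc.prems(4,5) by simp
  moreover have "1 \<le> card d ^ l"
    using Suc.prems(4) by simp
  ultimately obtain v where v: "v \<in> V" "\<And>w. w \<in> d \<Longrightarrow> \<exists>f\<in>?C. f v \<noteq> w"
    using exists_nonconstant_vertex[of V E d] by (metis le_less_trans)
  obtain w where w: "w \<in> d" "card d ^ l < card d * card {f \<in> ?C. f v = w}"
  proof -
    \<comment> \<open>Rounding down covers \<open>l = 0\<close>, where \<open>card d\<close> need
      not divide \<open>card d ^ l\<close>. The strict inequality for the frequency undoes the
      rounding.\<close>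
    have "card d * ((card d ^ l) div card d) < card ?C"
      using many by (meson le_less_trans times_div_less_eq_dividend)
    then obtain w where "w \<in> d" "(card d ^ l) div card d < card {f \<in> ?C. f v = w}"
      using exists_frequent_colour[OF Suc.prems(1) d v(1)] by blast
    moreover from this have "card d ^ l < card d * card {f \<in> ?C. f v = w}"
      using Suc.prems(4) by (simp add: div_less_iff_less_mult mult.commute)
    ultimately show ?thesis
      using that by blast
  qed
  \<comment> \<open>Vertices of \<open>d\<close> have constant colour. Hence \<open>d\<close>
    survives the identification as an edge.\<close>
  have "v \<notin> d"
    using v by (auto simp: edge_colourings_def)
  let ?m = "id(v := w)"
  have "{f \<in> ?C. f v = w} \<noteq> {}"
    using w(2) by (metis card.empty mult_0_right not_less_zero)
  then obtain f where f: "f \<in> ?C" "f v = w"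
    by auto
  obtain g where g: "g \<in> ?C" "g v \<noteq> w"
    using v(2) w(1) by blast
  moreover have "g v \<in> d"
    using g v(1) by (auto simp: edge_colourings_def)
  ultimately have "card (image ?m ` E) = card E"
    using inj_on_identify_vertices[OF w(1) f] by (intro card_image) auto
  moreover have "\<exists>s. length s = card d \<and> (\<forall>x\<in>set s. 0 < x) \<and> sum_list s + l = card (V - {v})
      \<and> card (image ?m ` E) \<le> prod_list s"
  proof (rule Suc.IH)
    have "?m ` d = d"
      using \<open>v \<notin> d\<close> by auto
    then show "d \<in> image ?m ` E"
      using Suc.prems(3) by (metis imageI)
    show "e \<subseteq> V - {v}" if "e \<in> image ?m ` E" for e
    proof -
      obtain c where c: "c \<in> E" "e = ?m ` c"
        using \<open>e \<in> image ?m ` E\<close> by blast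
      have "w \<in> V" "w \<noteq> v"
        using w(1) d \<open>v \<notin> d\<close> by auto
      then show ?thesis
        using Suc.prems(2)[OF c(1)] by (auto simp: c(2))
    qed
    show "card d ^ l < card d * card (edge_colourings (V - {v}) (image ?m ` E) d)"
      using w card_colourings_identify_vertices[of V E d v w] Suc.prems(1,2) d v(1) \<open>v \<notin> d\<close>
      by (meson less_le_trans mult_le_mono2)
  qed (use Suc.prems in auto)
  moreover have "card V = Suc (card (V - {v}))"
    using Suc.prems(1) v(1) by (rule card.remove)
  ultimately show ?case
    by auto
qed

section \<open>The extremal construction\<close>

text \<open>Edges are the choice functions of the parts, hence their number. Isolated vertices
  impose no condition on a colouring, so each contributes a factor \<open>length s\<close> to the
  number of colourings exhibited.\<close>

lemma exists_complete_partite_hypergraph: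
  assumes "s \<noteq> []" and pos: "\<forall>x\<in>set s. 0 < x"
  shows "\<exists>(V :: 'a::infinite set) E. r_hypergraph (length s) V E \<and> E \<noteq> {}
    \<and> card V = sum_list s + l \<and> length s ^ l \<le> card (r_partitions V E) \<and> card E = prod_list s"
proof -
  let ?r = "length s"
  obtain h0 :: "nat \<Rightarrow> 'a" where "inj h0"
    using infinite_countable_subset[OF infinite_UNIV] by auto
  \<comment> \<open>An infinite type contains a copy of the pairs of naturals, which serve as vertex
    labels.\<close>
  define h where "h = h0 \<circ> prod_encode"
  have h: "inj h"
    unfolding h_def using \<open>inj h0\<close> inj_prod_encode by (rule inj_compose)
  \<comment> \<open>\<open>h (i, j)\<close> is the \<open>j\<close>-th point of the \<open>i\<close>-th part; \<open>i = length s\<close> stands for the isolated vertices.\<close>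
  define X where "X = (SIGMA i:{..<?r}. {..<s ! i})"
  define L where "L = {?r} \<times> {..<l}"
  define V where "V = h ` (X \<union> L)"
  define T where "T = (\<Pi>\<^sub>E i\<in>{..<?r}. {..<s ! i})"
  define edge where "edge = (\<lambda>t. h ` (\<lambda>i. (i, t i)) ` {..<?r})"
  define E where "E = edge ` T"
  \<comment> \<open>The reference edge takes point \<open>0\<close> of every part; this point exists
    because the entries of \<open>s\<close> are positive.\<close>
  define d where "d = edge (restrict (\<lambda>_. 0) {..<?r})"
  have fin: "finite X" "finite L"
    by (auto simp: X_def L_def)
  have "X \<inter> L = {}"
    by (auto simp: X_def L_def)
  have cardX: "card X = sum_list s"
    by (simp add: X_def sum_list_sum_nth atLeast0LessThan)
  have "card V = card (X \<union> L)"
    unfolding V_def using h by (intro card_image) (auto intro: inj_on_subset)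
  then have cardV: "card V = sum_list s + l"
    using fin \<open>X \<inter> L = {}\<close> cardX by (simp add: card_Un_disjoint L_def card_cartesian_product)
  have d_eq: "d = (\<lambda>i. h (i, 0)) ` {..<?r}"
    by (auto simp: d_def edge_def)
  have "inj_on edge T"
  proof (rule inj_onI)
    fix t u assume t: "t \<in> T" and u: "u \<in> T" and "edge t = edge u"
    then have eq: "(\<lambda>i. (i, t i)) ` {..<?r} = (\<lambda>i. (i, u i)) ` {..<?r}"
      using h by (simp add: edge_def inj_image_eq_iff)
    show "t = u"
      using t u unfolding T_def
    proof (rule PiE_ext)
      show "t i = u i" if "i \<in> {..<?r}" for i
        using eq that by auto
    qed
  qed
  then have cardE: "card E = prod_list s"
    by (simp add: E_def card_image T_def card_PiE prod.list_conv_set_nth atLeast0LessThan)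
  have "restrict (\<lambda>_. 0) {..<?r} \<in> T"
    using pos by (auto simp: T_def)
  then have dE: "d \<in> E"
    by (auto simp: d_def E_def)
  have sub: "e \<subseteq> h ` X" if "e \<in> E" for e
    using that by (fastforce simp: E_def edge_def T_def X_def)
  then have subV: "e \<subseteq> V" if "e \<in> E" for e
    using that by (auto simp: V_def)
  have card_edge: "card (edge t) = ?r" for t
  proof -
    have "inj_on (\<lambda>i. h (i, t i)) {..<?r}"
      using h by (auto simp: inj_on_def)
    then show ?thesis
      by (simp add: edge_def image_image card_image)
  qed
  have "card e = ?r" if "e \<in> E" for e
    using that card_edge by (auto simp: E_def)
  moreover have "e \<noteq> {}" if "e \<in> E" for e
    using that \<open>s \<noteq> []\<close> by (auto simp: E_def edge_def)
  moreover have "finite V"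
    using fin by (simp add: V_def)
  ultimately have hyp: "r_hypergraph ?r V E"
    using subV by (auto simp: r_hypergraph_def hypergraph_def)
  \<comment> \<open>Each part receives its point \<open>0\<close> as colour, while \<open>a\<close>
    colours the isolated vertices freely.\<close>
  define col where
    "col = (\<lambda>a. restrict (\<lambda>x. if x \<in> h ` L then a x else h (fst (inv h x), 0)) V)"
  have colX: "col a (h (i, j)) = h (i, 0)" if "i < ?r" "j < s ! i" for a i j
  proof -
    have "h (i, j) \<notin> h ` L"
      using that h by (auto simp: L_def inj_image_mem_iff)
    moreover have "h (i, j) \<in> V"
      using that by (auto simp: V_def X_def)
    ultimately show ?thesis
      using h by (simp add: col_def)
  qed
  have "card (h ` L \<rightarrow>\<^sub>E d) \<le> card (edge_colourings V E d)"
  proof (rule card_inj_on_le)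
    show "finite (edge_colourings V E d)"
      using \<open>finite V\<close> subV[OF dE] by (rule finite_edge_colourings)
    show "inj_on col (h ` L \<rightarrow>\<^sub>E d)"
    proof (rule inj_onI)
      fix a b assume a: "a \<in> h ` L \<rightarrow>\<^sub>E d" and b: "b \<in> h ` L \<rightarrow>\<^sub>E d" and eq: "col a = col b"
      from a b show "a = b"
      proof (rule PiE_ext)
        show "a x = b x" if "x \<in> h ` L" for x
          using fun_cong[OF eq, of x] that by (auto simp: col_def V_def)
      qed
    qed
    show "col ` (h ` L \<rightarrow>\<^sub>E d) \<subseteq> edge_colourings V E d"
    proof (rule image_subsetI)
      fix a assume a: "a \<in> h ` L \<rightarrow>\<^sub>E d"
      have "col a x \<in> d" if x: "x \<in> V" for x
      proof (cases "x \<in> h ` L")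
        case True
        then show ?thesis
          using a x by (auto simp: col_def)
      next
        case False
        then obtain i j where "x = h (i, j)" "i < ?r" "j < s ! i"
          using x by (auto simp: V_def X_def)
        then show ?thesis
          using colX by (auto simp: d_eq)
      qed
      then have "col a \<in> V \<rightarrow>\<^sub>E d"
        by (auto simp: col_def)
      moreover have "col a x = x" if "x \<in> d" for x
        using that colX pos by (auto simp: d_eq)
      moreover have "bij_betw (col a) e d" if e: "e \<in> E" for e
      proof -
        obtain t where t: "t \<in> T" "e = edge t"
          using e by (auto simp: E_def)
        then have t_less: "t i < s ! i" if "i < ?r" for i
          using that by (auto simp: T_def)
        have "inj_on (col a) e"
        proof (rule inj_onI)
          fix x y assume xy: "x \<in> e" "y \<in> e" "col a x = col a y"
          then obtain i j where "x = h (i, t i)" "y = h (j, t j)" "i < ?r" "j < ?r"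
            using t by (auto simp: edge_def)
          then show "x = y"
            using xy(3) colX t_less h by (auto dest: injD)
        qed
        moreover have "col a ` e = d"
          using t_less colX by (force simp: t d_eq edge_def image_image)
        ultimately show ?thesis
          by (simp add: bij_betw_def)
      qed
      ultimately show "col a \<in> edge_colourings V E d"
        by (simp add: edge_colourings_def)
    qed
  qed
  moreover have "card (h ` L) = l"
    using card_image[OF inj_on_subset[OF h subset_UNIV], of L]
    by (simp add: L_def card_cartesian_product)
  moreover have "card d = ?r"
    using card_edge by (simp add: d_def)
  ultimately have "?r ^ l \<le> card (r_partitions V E)"
    using fin card_r_partitions_eq[OF subV dE] by (simp add: card_funcsetE)
  then show ?thesis
    using hyp dE cardV cardE by blast
qed

section \<open>The logarithm and the final assembly\<close>

text \<open>These bounds say that \<open>l\<close> is the least exponent with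
  \<open>p \<le> r ^ l\<close>. The first serves the construction; the second, again free of
  \<open>l - 1\<close>, feeds the induction.\<close>

lemma nat_ceiling_log_bounds:
  fixes p r l :: nat
  assumes "1 \<le> p" "2 \<le> r" "l = nat \<lceil>log (real r) (real p)\<rceil>"
  shows "p \<le> r ^ l" "r ^ l < r * p"
proof -
  \<comment> \<open>Non-negativity ensures that \<open>nat\<close> does not truncate the
    ceiling.\<close>
  have log: "0 \<le> log r p"
    using assms by simp
  then have "log r p \<le> real l" "real l < log r p + 1"
    using assms(3) by linarith+
  then have "p \<le> r powr l" "r powr l < r powr (log r p + 1)"
    using assms(1,2) log_le_iff[of r p "real l"] by auto
  moreover have "r powr (log r p + 1) = r * p"
    using assms by (simp add: powr_add)
  moreover have "r powr l = real (r ^ l)"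
    using assms(2) by (simp add: powr_realpow)
  ultimately have "real p \<le> real (r ^ l)" "real (r ^ l) < real (r * p)"
    by simp_all
  then show "p \<le> r ^ l" "r ^ l < r * p"
    by (simp_all only: of_nat_le_iff of_nat_less_iff)
qed

theorem theorem3p6:
  fixes n p r l :: nat
  assumes "n \<ge> 1" and "p \<ge> 1" and "r \<ge> 2"
    and "l = nat \<lceil>log (real r) (real p)\<rceil>"
  shows "((\<exists>(V :: 'a::infinite set) E. r_hypergraph r V E \<and> E \<noteq> {} \<and> card V = n
            \<and> p \<le> card (r_partitions V E)) \<longleftrightarrow> r + l \<le> n)
    \<and> (r + l \<le> n \<longrightarrow>
         Max {card E | (V :: 'a set) E. r_hypergraph r V E \<and> E \<noteq> {} \<and> card V = n
            \<and> p \<le> card (r_partitions V E)} = max_prod r (n - l))"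
proof -
  note p_bounds = nat_ceiling_log_bounds[OF assms(2-4)]
  let ?good = "\<lambda>(V :: 'a set) E. r_hypergraph r V E \<and> E \<noteq> {} \<and> card V = n
    \<and> p \<le> card (r_partitions V E)"
  let ?S = "{prod_list s | s :: nat list. length s = r \<and> (\<forall>x\<in>set s. 0 < x) \<and> sum_list s = n - l}"
  \<comment> \<open>One list serves both claims: its \<open>r\<close> positive entries sum to
    \<open>n - l\<close>, forcing \<open>r + l \<le> n\<close>, and its product competes in
    \<open>max_prod\<close>.\<close>
  have upper: "r + l \<le> n \<and> card E \<le> max_prod r (n - l)" if good: "?good V E" for V :: "'a set" and E
  proof -
    obtain d where d: "d \<in> E"
      using good by auto
    have fin: "finite V" and sub: "\<And>e. e \<in> E \<Longrightarrow> e \<subseteq> V" and "card d = r"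
      using good d by (auto simp: r_hypergraph_def hypergraph_def)
    have "r ^ l < r * card (r_partitions V E)"
      using p_bounds(2) good by (meson less_le_trans mult_le_mono2)
    then have "card d ^ l < card d * card (edge_colourings V E d)"
      using card_r_partitions_eq[OF sub d] \<open>card d = r\<close> by simp
    then obtain s where s: "length s = r" "\<forall>x\<in>set s. 0 < x" "sum_list s + l = n"
      "card E \<le> prod_list s"
      using card_edges_le_of_many_colourings[OF fin sub d] \<open>card d = r\<close> \<open>r \<ge> 2\<close> good by auto
    have "length s \<le> sum_list s"
      using s(2) by (induction s) auto
    moreover have "prod_list s \<in> ?S"
      using s by auto
    then have "prod_list s \<le> max_prod r (n - l)"
      unfolding max_prod_def using finite_max_prod by (rule Max_ge[rotated])
    ultimately show ?thesis
      using s by auto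
  qed
  \<comment> \<open>The part sizes are a maximiser in \<open>max_prod\<close>, which exists since
    \<open>r \<le> n - l\<close>.\<close>
  have attained: "\<exists>(V :: 'a set) E. ?good V E \<and> card E = max_prod r (n - l)" if le: "r + l \<le> n"
  proof -
    have "max_prod r (n - l) \<in> ?S"
      unfolding max_prod_def
      using le assms(3) by (intro Max_in finite_max_prod max_prod_nonempty) auto
    then obtain s where s: "max_prod r (n - l) = prod_list s" "length s = r" "\<forall>x\<in>set s. 0 < x"
      "sum_list s = n - l"
      by auto
    then have "s \<noteq> []"
      using assms(3) by auto
    then obtain V :: "'a set" and E where "r_hypergraph r V E" "E \<noteq> {}" "card V = n - l + l"
      "r ^ l \<le> card (r_partitions V E)" "card E = prod_list s"
      using exists_complete_partite_hypergraph[of s l] s by metis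
    moreover from this have "p \<le> card (r_partitions V E)"
      using p_bounds(1) by simp
    ultimately have "?good V E \<and> card E = max_prod r (n - l)"
      using s(1) le by simp
    then show ?thesis
      by blast
  qed
  have "Max {card E | (V :: 'a set) E. ?good V E} = max_prod r (n - l)" if le: "r + l \<le> n"
  proof (rule Max_eqI)
    show "finite {card E | (V :: 'a set) E. ?good V E}"
      by (rule finite_edge_counts)
    show "k \<le> max_prod r (n - l)" if "k \<in> {card E | (V :: 'a set) E. ?good V E}" for k
      using that upper by blast
    obtain V :: "'a set" and E where "?good V E" "card E = max_prod r (n - l)"
      using attained[OF le] by blast
    then show "max_prod r (n - l) \<in> {card E | (V :: 'a set) E. ?good V E}"
      by (intro CollectI exI[of _ V] exI[of _ E]) simp
  qed
  then show ?thesis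
    using upper attained by blast
qed

end
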